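(* Let $n\ge 1$, let $g$ be an admissible function (as defined in the context), let $\alpha\in[0,1)$ and $\beta\in(-\frac{\pi}{2},\frac{\pi}{2})$. If $F\in\widehat{\mathcal S}_g^{\alpha,\beta}(\mathbb B^n)$, then for every $z\in\mathbb B^n$ $$\Phi_1\le \|F(z)\|\le \Phi_2,$$ where $$\Phi_1=\|z\|\exp\int_{0}^{\|z\|}\left(\frac{1}{(1-\alpha)\left(\max\{g(y),g(-y)\}+\frac{\alpha}{1-\alpha}\right)}-1\right)\frac{1}{y}\,dy$$ and $$\Phi_2=\|z\|\exp\int_{0}^{\|z\|}\left(\frac{1}{(1-\alpha)\left(\min\{g(y),g(-y)\}+\frac{\alpha}{1-\alpha}\right)}-1\right)\frac{1}{y}\,dy.$$
   Context: $\mathbb B^n$ is the open Euclidean unit ball of $\mathbb C^n$ with inner product $\langle z,w\rangle=\sum_j z_j\overline{w_j}$ and norm $\|z\|=\sqrt{\langle z,z\rangle}$; $\mathbb D=\mathbb B^1$. $H(\mathbb B^n)$ is the set of holomorphic mappings $\mathbb B^n\to\mathbb C^n$; $J_f(z)$ is the complex Jacobian matrix of $f$ at $z$; $I_n$ is the identity matrix. Admissible function: a univalent holomorphic function $g:\mathbb D\to\mathbb C$ with $g(0)=1$, $g(\overline\zeta)=\overline{g(\zeta)}$ and $\Re g(\zeta)>0$ for all $\zeta\in\mathbb D$, and such that for every $r\in(0,1)$, $\min_{|\zeta|=r}\Re g(\zeta)=\min\{g(r),g(-r)\}$ and $\max_{|\zeta|=r}\Re g(\zeta)=\max\{g(r),g(-r)\}$.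 For $\alpha\in[0,1)$, $\beta\in(-\frac\pi2,\frac\pi2)$, with $i=\sqrt{-1}$, $\widetilde{\mathcal M}_g^{\alpha,\beta}$ is the set of $h\in H(\mathbb B^n)$ with $h(0)=0$, $J_h(0)=I_n$ and $$\frac{-\alpha+i\tan\beta}{1-\alpha}+\frac{1-i\tan\beta}{1-\alpha}\left\langle h(z),\frac{z}{\|z\|^2}\right\rangle\in g(\mathbb D)\quad\text{for all } z\in\mathbb B^n\setminus\{0\}.$$ $\widehat{\mathcal S}_g^{\alpha,\beta}(\mathbb B^n)$ is the set of $f\in H(\mathbb B^n)$ with $f(0)=0$, $J_f(0)=I_n$, $J_f(z)$ nonsingular at every $z\in\mathbb B^n$, such that the mapping $z\mapsto [J_f(z)]^{-1}f(z)$ belongs to $\widetilde{\mathcal M}_g^{\alpha,\beta}$. *)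

theory Defs
  imports "HOL-Complex_Analysis.Complex_Analysis"
begin

definition cinner :: "complex ^ 'n \<Rightarrow> complex ^ 'n \<Rightarrow> complex" where
  "cinner z w = (\<Sum>j\<in>UNIV. z $ j * cnj (w $ j))"

lemma norm_eq_sqrt_cinner:
  fixes z :: "complex ^ 'n"
  shows "complex_of_real (norm z) ^ 2 = cinner z z" and "norm z = sqrt (Re (cinner z z))"
proof -
  show *: "complex_of_real (norm z) ^ 2 = cinner z z"
    by (simp add: cinner_def norm_vec_def L2_set_def sum_nonneg complex_norm_square
        flip: of_real_power)
  then show "norm z = sqrt (Re (cinner z z))"
    by (metis Re_complex_of_real norm_ge_zero of_real_power real_sqrt_unique)
qed

(* Holomorphy of maps from an open subset of C^n to C^m: Frechet differentiability with a
   complex-linear derivative. *)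
definition holomorphic_map_on :: "(complex ^ 'n \<Rightarrow> complex ^ 'm) \<Rightarrow> (complex ^ 'n) set \<Rightarrow> bool" where
  "holomorphic_map_on f S \<longleftrightarrow>
     (\<forall>z\<in>S. \<exists>A :: complex ^ 'n ^ 'm. (f has_derivative (\<lambda>v. A *v v)) (at z))"

(* The library's jacobian, instantiated to the scalar type complex, applies the Frechet derivative
   to the standard basis vectors of C^n. For holomorphic f this is the complex Jacobian matrix:
   it represents the derivative, and its (i, j) entry is the partial derivative of f_i with
   respect to z_j. *)
lemma jacobian_holomorphic:
  fixes f :: "complex ^ 'n \<Rightarrow> complex ^ 'm" and A :: "complex ^ 'n ^ 'm"
  assumes "(f has_derivative (\<lambda>v. A *v v)) (at z)"
  shows "jacobian f (at z) = A"
    and "jacobian f (at z) $ i $ j = deriv (\<lambda>t. f (z + t *s axis j 1) $ i) 0"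
proof -
  show *: "jacobian f (at z) = A"
    using frechet_derivative_at[OF assms]
    by (metis jacobian_def matrix_of_matrix_vector_mul)
  have "((\<lambda>t. f (z + t *s axis j 1) $ i) has_field_derivative A $ i $ j) (at 0)"
  proof -
    have lin: "bounded_linear (\<lambda>t :: complex. t *s (axis j 1 :: complex ^ 'n))"
      by (rule linear_conv_bounded_linear[THEN iffD1])
        (rule linearI; simp add: vec_eq_iff algebra_simps)
    have "((\<lambda>t. z + t *s axis j 1) has_derivative (\<lambda>t. t *s axis j 1)) (at (0 :: complex))"
      by (auto intro!: derivative_eq_intros bounded_linear.has_derivative[OF lin])
    moreover have "(f has_derivative (\<lambda>v. A *v v)) (at (z + (0 :: complex) *s axis j 1))"
      using assms by simp
    ultimately have "(f \<circ> (\<lambda>t. z + t *s axis j 1) has_derivative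
        (\<lambda>v. A *v v) \<circ> (\<lambda>t. t *s axis j 1)) (at (0 :: complex))"
      using diff_chain_at by blast
    then have "((\<lambda>t. f (z + t *s axis j 1) $ i) has_derivative
        (\<lambda>t. (A *v (t *s axis j 1)) $ i)) (at (0 :: complex))"
      by (auto simp: o_def dest: bounded_linear.has_derivative[OF bounded_linear_vec_nth])
    moreover have "(A *v (t *s axis j 1)) $ i = A $ i $ j * t" for t
      by (simp add: matrix_vector_mult_def axis_def if_distrib cong: if_cong)
    ultimately show "((\<lambda>t. f (z + t *s axis j 1) $ i) has_field_derivative A $ i $ j) (at 0)"
      by (simp add: has_field_derivative_def)
  qed
  then show "jacobian f (at z) $ i $ j = deriv (\<lambda>t. f (z + t *s axis j 1) $ i) 0"
    using * by (simp add: DERIV_imp_deriv)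
qed

(* Since g (cnj \<zeta>) = cnj (g \<zeta>), the values of g on the real axis are real; Re (g r) and
   Re (g (-r)) below are just these values, as elements of type real. The infimum and
   supremum are a minimum and a maximum by compactness of the circle. *)
definition admissible :: "(complex \<Rightarrow> complex) \<Rightarrow> bool" where
  "admissible g \<longleftrightarrow>
     g holomorphic_on ball 0 1 \<and> inj_on g (ball 0 1) \<and> g 0 = 1 \<and>
     (\<forall>\<zeta>\<in>ball 0 1. g (cnj \<zeta>) = cnj (g \<zeta>) \<and> Re (g \<zeta>) > 0) \<and>
     (\<forall>r::real. 0 < r \<and> r < 1 \<longrightarrow>
        (INF \<zeta>\<in>sphere 0 r. Re (g \<zeta>)) = min (Re (g (of_real r))) (Re (g (- of_real r))) \<and>
        (SUP \<zeta>\<in>sphere 0 r. Re (g \<zeta>)) = max (Re (g (of_real r))) (Re (g (- of_real r))))"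

definition M_class :: "(complex \<Rightarrow> complex) \<Rightarrow> real \<Rightarrow> real \<Rightarrow> (complex ^ 'n \<Rightarrow> complex ^ 'n) set" where
  "M_class g \<alpha> \<beta> = {h. holomorphic_map_on h (ball 0 1) \<and> h 0 = 0 \<and>
     jacobian h (at 0) = mat 1 \<and>
     (\<forall>z\<in>ball 0 1 - {0}.
        (- of_real \<alpha> + \<i> * of_real (tan \<beta>)) / (1 - of_real \<alpha>)
          + (1 - \<i> * of_real (tan \<beta>)) / (1 - of_real \<alpha>)
            * cinner (h z) ((1 / (norm z)\<^sup>2) *\<^sub>R z)
        \<in> g ` ball 0 1)}"

definition S_class :: "(complex \<Rightarrow> complex) \<Rightarrow> real \<Rightarrow> real \<Rightarrow> (complex ^ 'n \<Rightarrow> complex ^ 'n) set" where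
  "S_class g \<alpha> \<beta> = {f. holomorphic_map_on f (ball 0 1) \<and> f 0 = 0 \<and>
     jacobian f (at 0) = mat 1 \<and>
     (\<forall>z\<in>ball 0 1. invertible (jacobian f (at z))) \<and>
     (\<lambda>z. matrix_inv (jacobian f (at z)) *v f z) \<in> M_class g \<alpha> \<beta>}"

end

theory Submission
  imports Defs
begin

text \<open>
  Put \<open>h = J\<^sub>F\<inverse> F\<close> and \<open>w = (1 - \<i> tan \<beta>) h\<close>. Infinitesimally along \<open>-w\<close>, \<open>ln \<parallel>F\<parallel>\<close>
  decreases at rate 1 and \<open>ln \<parallel>z\<parallel>\<close> at rate \<open>(1 - \<alpha>) Re g(\<xi>) + \<alpha>\<close>, where \<open>\<bar>\<xi>\<bar> \<le> \<parallel>z\<parallel>\<close> by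
  Schwarz's lemma on the complex line through \<open>z\<close>; the angle \<open>\<beta>\<close> drops out. Hence
  \<open>ln (\<parallel>F z\<parallel> / \<parallel>z\<parallel>)\<close> minus the integral in question is monotone along \<open>-w\<close>, and it tends to 0
  at the origin. Since \<open>-w\<close> points into the ball \<open>\<parallel>x\<parallel> \<le> r\<close>, an extremum over that ball (after an
  arbitrarily small multiple of \<open>\<parallel>z\<parallel>\<^sup>2\<close> is added) can only sit at the origin, so the flow of \<open>-w\<close>
  never has to be constructed. As \<open>g\<close> is real and injective on the real axis, it is monotone
  there, and the maximum and minimum of \<open>g(y)\<close>, \<open>g(-y)\<close> are \<open>g(\<sigma>y)\<close>, \<open>g(-\<sigma>y)\<close> for a fixed sign \<open>\<sigma>\<close>.
\<close>

section \<open>A minimum principle along descent directions\<close>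

text \<open>Adding \<open>e * (y \<bullet> y)\<close> with \<open>e > 0\<close> turns the weak
  decrease of \<open>L\<close> along \<open>- w\<close> into a strict one. As \<open>- w\<close>
  also shortens the vector, a small move stays in the ball even from its boundary sphere. Hence the
  minimum of the perturbed function, attained by compactness, sits at 0, where the value is 0; then
  \<open>e\<close> tends to 0.\<close>

lemma nonneg_if_descent_directions:
  fixes L :: "'a::euclidean_space \<Rightarrow> real"
  assumes cont: "continuous_on (cball 0 r) L" and L0: "L 0 = 0"
    and desc: "\<And>z. z \<in> cball 0 r \<Longrightarrow> z \<noteq> 0 \<Longrightarrow>
      \<exists>w D. 0 < w \<bullet> z \<and> D \<le> 0 \<and> ((\<lambda>t. L (z - t *\<^sub>R w)) has_real_derivative D) (at 0)"
    and z: "z \<in> cball 0 r"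
  shows "0 \<le> L z"
proof -
  have pert: "0 \<le> L z + e * (z \<bullet> z)" if e: "e > 0" for e
  proof -
    define N where "N y = L y + e * (y \<bullet> y)" for y
    have "continuous_on (cball 0 r) N"
      unfolding N_def by (intro continuous_intros cont)
    then obtain x where x: "x \<in> cball 0 r" and xmin: "\<And>y. y \<in> cball 0 r \<Longrightarrow> N x \<le> N y"
      using continuous_attains_inf[OF compact_cball, of 0 r N] z by (metis empty_iff)
    have "x = 0"
    proof (rule ccontr)
      assume "x \<noteq> 0"
      then obtain w D where w: "0 < w \<bullet> x" and D: "D \<le> 0"
        and dL: "((\<lambda>t. L (x - t *\<^sub>R w)) has_real_derivative D) (at 0)"
        using desc[OF x] by blast
      have sq: "((\<lambda>t. (x - t *\<^sub>R w) \<bullet> (x - t *\<^sub>R w)) has_real_derivative - 2 * (w \<bullet> x)) (at 0)"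
        unfolding has_field_derivative_def
        by (auto intro!: derivative_eq_intros simp: inner_commute algebra_simps)
      have dN: "((\<lambda>t. N (x - t *\<^sub>R w)) has_real_derivative D + e * (- 2 * (w \<bullet> x))) (at 0)"
        unfolding N_def by (intro DERIV_add dL DERIV_cmult sq)
      have neg: "D + e * (- 2 * (w \<bullet> x)) < 0"
        using D mult_pos_pos[OF e w] by (simp add: algebra_simps)
      obtain d1 where d1: "d1 > 0" "\<And>h. 0 < h \<Longrightarrow> h < d1 \<Longrightarrow> N (x - h *\<^sub>R w) < N x"
        using DERIV_neg_dec_right[OF dN neg] by auto
      obtain d2 where d2: "d2 > 0"
        "\<And>h. 0 < h \<Longrightarrow> h < d2 \<Longrightarrow> (x - h *\<^sub>R w) \<bullet> (x - h *\<^sub>R w) < x \<bullet> x"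
        using DERIV_neg_dec_right[OF sq] w by auto
      define h where "h = min d1 d2 / 2"
      have h: "0 < h" "h < d1" "h < d2"
        using d1(1) d2(1) by (auto simp: h_def)
      have "norm (x - h *\<^sub>R w) < norm x"
        using d2(2)[OF h(1,3)] by (simp add: norm_eq_sqrt_inner)
      then have "x - h *\<^sub>R w \<in> cball 0 r"
        using x by simp
      then show False
        using xmin d1(2)[OF h(1,2)] by force
    qed
    then show ?thesis
      using xmin[OF z] L0 by (simp add: N_def)
  qed
  show ?thesis
  proof (cases "z = 0")
    case False
    then have pos: "0 < z \<bullet> z" by simp
    show ?thesis
    proof (rule field_le_epsilon)
      fix e :: real assume "e > 0"
      then show "0 \<le> L z + e"
        using pert[of "e / (z \<bullet> z)"] pos by simp
    qed
  qed (simp add: L0)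
qed

section \<open>The integral of the logarithmic kernel\<close>

text \<open>The integrand of both bounds, with \<open>q y\<close> in place of (1 - \<alpha>) m +
  \<alpha>, where m is the maximum or the minimum of g(y) and g(-y).\<close>

definition log_kernel :: "(real \<Rightarrow> real) \<Rightarrow> real \<Rightarrow> real" where
  "log_kernel q y = (1 / q y - 1) * (1 / y)"

text \<open>The singularity at 0 is removable: because \<open>q 0 = 1\<close>, the kernel equals
  minus the difference quotient of \<open>q\<close> at 0, divided by \<open>q\<close>, and so tends
  to \<open>- d\<close>. The continuous extension \<open>k\<close> differs from it at most at one
  point and has the same integrals, so the fundamental theorem of calculus applies to
  \<open>k\<close>.\<close>

lemma
  fixes q :: "real \<Rightarrow> real"
  assumes cont: "continuous_on {0..<R} q" and pos: "\<And>y. y \<in> {0..<R} \<Longrightarrow> 0 < q y"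
    and q0: "q 0 = 1" and dq: "(q has_real_derivative d) (at 0 within {0..})"
  shows continuous_on_integral_log_kernel:
      "r < R \<Longrightarrow> continuous_on {0..r} (\<lambda>x. integral {0..x} (log_kernel q))"
    and has_real_derivative_integral_log_kernel:
      "0 < r \<Longrightarrow> r < R \<Longrightarrow>
        ((\<lambda>x. integral {0..x} (log_kernel q)) has_real_derivative log_kernel q r) (at r)"
proof -
  define k where "k y = (if y = 0 then - d else log_kernel q y)" for y
  have contk: "continuous_on {0..b} k" if b: "b < R" for b
    unfolding continuous_on_eq_continuous_within
  proof
    fix y assume y: "y \<in> {0..b}"
    have ltR: "{0..b} \<subseteq> {0..<R}" using b by auto
    have cq: "continuous (at y within {0..b}) q"
      using continuous_on_subset[OF cont ltR] y
      by (simp add: continuous_on_eq_continuous_within)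
    show "continuous (at y within {0..b}) k"
    proof (cases "y = 0")
      case True
      have d': "((\<lambda>x. (q x - 1) / x) \<longlongrightarrow> d) (at 0 within {0..b})"
        using DERIV_subset[OF dq, of "{0..b}"] q0 by (simp add: has_field_derivative_iff)
      have q': "(q \<longlongrightarrow> 1) (at 0 within {0..b})"
        using cq True q0 by (simp add: continuous_within)
      have "((\<lambda>x. - ((q x - 1) / x) / q x) \<longlongrightarrow> - d / 1) (at 0 within {0..b})"
        by (intro tendsto_intros d' q') simp
      moreover have "\<forall>\<^sub>F x in at 0 within {0..b}. - ((q x - 1) / x) / q x = k x"
      proof -
        have "- ((q x - 1) / x) / q x = k x" if "x \<in> {0..b}" "x \<noteq> 0" for x
          using pos[of x] that ltR unfolding k_def log_kernel_def
          by (auto simp: field_simps)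
        then show ?thesis
          by (auto simp: eventually_at_filter)
      qed
      ultimately have "(k \<longlongrightarrow> - d) (at 0 within {0..b})"
        by (simp add: tendsto_cong)
      then show ?thesis
        using True by (simp add: continuous_within k_def)
    next
      case False
      have ne: "q y \<noteq> 0" using pos[of y] y ltR by auto
      have lk: "continuous (at y within {0..b}) (log_kernel q)"
        unfolding log_kernel_def using False ne by (intro continuous_intros cq) auto
      have "\<forall>\<^sub>F x in at y within {0..b}. log_kernel q x = k x"
        unfolding eventually_at_filter
        by (rule eventually_mono[OF t1_space_nhds[OF False]]) (simp add: k_def)
      moreover have "k y = log_kernel q y" using False by (simp add: k_def)
      ultimately show ?thesis
        using lk by (metis continuous_within Lim_transform_eventually)
    qed
  qed
  have eq: "integral {0..x} (log_kernel q) = integral {0..x} k" for x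
    by (rule integral_spike[of "{0}"]) (auto simp: k_def)
  show "continuous_on {0..r} (\<lambda>x. integral {0..x} (log_kernel q))" if "r < R"
    unfolding eq using contk[OF that]
    by (intro indefinite_integral_continuous_1 integrable_continuous_interval)
  show "((\<lambda>x. integral {0..x} (log_kernel q)) has_real_derivative log_kernel q r) (at r)"
    if r: "0 < r" "r < R"
  proof -
    \<comment> \<open>Room to the right of \<open>r\<close> makes it an interior point of
      \<open>{0..b}\<close>, so the derivative within the interval is two-sided.\<close>
    obtain b where b: "r < b" "b < R" using r dense by blast
    have "((\<lambda>x. integral {0..x} k) has_real_derivative k r) (at r within {0..b})"
      using r b by (intro integral_has_real_derivative contk) auto
    moreover have "at r within {0..b} = at r"
      using r b by (intro at_within_interior) auto
    ultimately show ?thesis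
      unfolding eq using r by (simp add: k_def)
  qed
qed

section \<open>Comparison of logarithmic growth rates\<close>

text \<open>The sign \<open>s = 1\<close> gives the lower estimate of \<open>norm (F z)\<close> and \<open>s = - 1\<close> the upper one.\<close>
lemma log_growth_comparison:
  fixes F :: "'a::euclidean_space \<Rightarrow> 'a" and q :: "real \<Rightarrow> real" and s :: real
  assumes contF: "continuous_on (ball 0 1) F"
    and F0: "F 0 = 0" "(F has_derivative (\<lambda>v. v)) (at 0)"
    and nz: "\<And>z. z \<in> ball 0 1 \<Longrightarrow> z \<noteq> 0 \<Longrightarrow> F z \<noteq> 0"
    and dir: "\<And>z. z \<in> ball 0 1 \<Longrightarrow> z \<noteq> 0 \<Longrightarrow> \<exists>w F'. (F has_derivative F') (at z) \<and>
        F' w \<bullet> F z = F z \<bullet> F z \<and> 0 < w \<bullet> z \<and> s * (w \<bullet> z) \<le> s * (q (norm z) * (norm z)\<^sup>2)"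
    and contq: "continuous_on {0..<1} q" and posq: "\<And>y. y \<in> {0..<1} \<Longrightarrow> 0 < q y"
    and q0: "q 0 = 1" and dq: "(q has_real_derivative d) (at 0 within {0..})"
    and z: "z \<in> ball 0 1" "z \<noteq> 0"
  shows "0 \<le> s * (ln (norm (F z) / norm z) - integral {0..norm z} (log_kernel q))"
proof -
  define I where "I x = integral {0..x} (log_kernel q)" for x
  \<comment> \<open>The value 1 at the origin is the limit of the quotient, because the derivative
    of \<open>F\<close> there is the identity; it makes \<open>L\<close> continuous with
    \<open>L 0 = 0\<close>.\<close>
  define Q where "Q y = (if y = 0 then 1 else norm (F y) / norm y)" for y
  define L where "L y = s * (ln (Q y) - I (norm y))" for y
  have Qpos: "0 < Q y" if "y \<in> ball 0 1" for y
    using nz[OF that] by (simp add: Q_def)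
  have sub: "cball 0 (norm z) \<subseteq> ball (0::'a) 1"
    using z by auto
  have contQ: "continuous_on (cball 0 (norm z)) Q"
    unfolding continuous_on_eq_continuous_within
  proof
    fix y :: 'a assume y: "y \<in> cball 0 (norm z)"
    show "continuous (at y within cball 0 (norm z)) Q"
    proof (cases "y = 0")
      case True
      have "(\<lambda>x. norm (F x - x) / norm x) \<midarrow>0\<rightarrow> 0"
        using F0 by (simp add: has_derivative_iff_norm)
      then have "(\<lambda>x. Q x - 1) \<midarrow>0\<rightarrow> 0"
      proof (rule Lim_null_comparison[rotated])
        have "norm (Q x - 1) \<le> norm (F x - x) / norm x" if "x \<noteq> 0" for x
        proof -
          have "Q x - 1 = (norm (F x) - norm x) / norm x"
            using that by (simp add: Q_def diff_divide_distrib)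
          then show ?thesis
            using norm_triangle_ineq3[of "F x" x] by (simp add: divide_right_mono)
        qed
        then show "\<forall>\<^sub>F x in at 0. norm (Q x - 1) \<le> norm (F x - x) / norm x"
          by (simp add: eventually_at_filter)
      qed
      then have "Q \<midarrow>0\<rightarrow> Q 0"
        using LIM_zero_cancel[of Q 1 "at 0"] by (simp add: Q_def[of 0])
      then show ?thesis
        using True by (simp add: continuous_within tendsto_within_subset[of _ _ _ UNIV])
    next
      case False
      have "continuous_on (ball 0 1 - {0}) (\<lambda>x. norm (F x) / norm x)"
        by (intro continuous_intros continuous_on_subset[OF contF]) auto
      then have "continuous_on (ball 0 1 - {0}) Q"
        by (rule continuous_on_eq) (simp add: Q_def)
      then have "isCont Q y"
        using False y sub
        by (subst (asm) continuous_on_eq_continuous_at[OF open_delete[OF open_ball]]) auto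
      then show ?thesis
        by (rule continuous_at_imp_continuous_at_within)
    qed
  qed
  have contI: "continuous_on {0..norm z} I"
    unfolding I_def using continuous_on_integral_log_kernel[OF contq posq q0 dq] z by simp
  have "continuous_on (cball 0 (norm z)) L"
    unfolding L_def using Qpos[THEN less_imp_neq] sub
    by (intro continuous_intros contQ continuous_on_compose2[OF contI]) force+
  moreover have "L 0 = 0"
    by (simp add: L_def Q_def I_def)
  moreover have "\<exists>w D. 0 < w \<bullet> y \<and> D \<le> 0 \<and> ((\<lambda>t. L (y - t *\<^sub>R w)) has_real_derivative D) (at 0)"
    if y: "y \<in> cball 0 (norm z)" "y \<noteq> 0" for y
  proof -
    have y1: "y \<in> ball 0 1" using y sub by auto
    obtain w F' where F': "(F has_derivative F') (at y)" and eig: "F' w \<bullet> F y = F y \<bullet> F y"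
      and w: "0 < w \<bullet> y" and cmp: "s * (w \<bullet> y) \<le> s * (q (norm y) * (norm y)\<^sup>2)"
      using dir[OF y1 y(2)] by blast
    define \<rho> where "\<rho> = norm y"
    \<comment> \<open>\<open>A\<close> is the rate at which the logarithm of the norm decreases at
      \<open>y\<close> along \<open>- w\<close>; it is to be compared with
      \<open>q \<rho>\<close>.\<close>
    define A where "A = (w \<bullet> y) / \<rho>\<^sup>2"
    have \<rho>: "0 < \<rho>" "\<rho> < 1" using y y1 by (auto simp: \<rho>_def)
    have qp: "0 < q \<rho>" using posq \<rho> by auto
    have wy: "w \<bullet> y = A * \<rho>\<^sup>2" using \<rho> by (simp add: A_def)
    have dline: "((\<lambda>t. y - t *\<^sub>R w) has_derivative (\<lambda>t. - (t *\<^sub>R w))) (at (0::real))"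
      by (auto intro!: derivative_eq_intros)
    have "((\<lambda>t. F (y - t *\<^sub>R w)) has_derivative (\<lambda>t. F' (- (t *\<^sub>R w)))) (at 0)"
      using diff_chain_at[OF dline, of F F'] F' by (simp add: o_def)
    moreover have "F' (- (t *\<^sub>R w)) = - (t *\<^sub>R F' w)" for t
      using has_derivative_linear[OF F'] by (simp add: linear_neg linear_cmul)
    ultimately have dF: "((\<lambda>t. F (y - t *\<^sub>R w)) has_derivative (\<lambda>t. - (t *\<^sub>R F' w))) (at 0)"
      by simp
    have Fy: "F y \<noteq> 0" using nz y1 y by blast
    have dn: "((\<lambda>t. norm (y - t *\<^sub>R w)) has_real_derivative - (A * \<rho>)) (at 0)"
      unfolding has_field_derivative_def
      by (rule has_derivative_eq_rhs[OF has_derivative_compose[OF dline has_derivative_norm]])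
        (use y wy \<rho> in \<open>auto simp: sgn_div_norm inner_commute \<rho>_def power2_eq_square\<close>)
    \<comment> \<open>The derivative is \<open>- (F' w \<bullet> F y) / norm (F y)\<close>, which
      \<open>eig\<close> simplifies; hence the logarithm of \<open>norm (F y)\<close> decreases at
      rate exactly 1.\<close>
    have dnF: "((\<lambda>t. norm (F (y - t *\<^sub>R w))) has_real_derivative - norm (F y)) (at 0)"
      unfolding has_field_derivative_def
      by (rule has_derivative_eq_rhs[OF has_derivative_compose[OF dF has_derivative_norm]])
        (use Fy eig in \<open>auto simp: sgn_div_norm inner_commute dot_square_norm power2_eq_square\<close>)
    have dI: "(I has_real_derivative log_kernel q \<rho>) (at \<rho>)"
      unfolding I_def using has_real_derivative_integral_log_kernel[OF contq posq q0 dq] \<rho> by simp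
    have "((\<lambda>t. I (norm (y - t *\<^sub>R w))) has_real_derivative log_kernel q \<rho> * - (A * \<rho>)) (at 0)"
      by (rule DERIV_chain2[OF _ dn]) (use dI \<rho>_def in simp)
    moreover have "((\<lambda>t. ln (norm (F (y - t *\<^sub>R w)))) has_real_derivative - 1) (at 0)"
      by (rule derivative_eq_intros dnF refl | use Fy in simp)+
    moreover have "((\<lambda>t. ln (norm (y - t *\<^sub>R w))) has_real_derivative - A) (at 0)"
      by (rule derivative_eq_intros dn refl | use y \<rho> \<rho>_def in simp)+
    ultimately have
      "((\<lambda>t. s * (ln (norm (F (y - t *\<^sub>R w))) - ln (norm (y - t *\<^sub>R w)) - I (norm (y - t *\<^sub>R w))))
        has_real_derivative s * (- 1 - - A - log_kernel q \<rho> * - (A * \<rho>))) (at 0)"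
      by (intro DERIV_cmult DERIV_diff)
    \<comment> \<open>The form of the kernel pays off here:
      \<open>log_kernel q \<rho> * \<rho>\<close> is \<open>1 / q \<rho> - 1\<close>, so the two
      terms with \<open>A\<close> add up to \<open>A / q \<rho>\<close>.\<close>
    moreover have "s * (- 1 - - A - log_kernel q \<rho> * - (A * \<rho>)) = s * (A / q \<rho> - 1)"
      using \<rho> qp by (simp add: log_kernel_def field_simps)
    ultimately have
      "((\<lambda>t. s * (ln (norm (F (y - t *\<^sub>R w))) - ln (norm (y - t *\<^sub>R w)) - I (norm (y - t *\<^sub>R w))))
        has_real_derivative s * (A / q \<rho> - 1)) (at 0)"
      by (simp only:)
    \<comment> \<open>The case distinction in \<open>Q\<close> lets \<open>L\<close> agree with the
      difference of logarithms only away from the origin; for small \<open>t\<close> the line stays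
      in the punctured ball.\<close>
    moreover have "\<forall>\<^sub>F t in nhds 0. 
       s * (ln (norm (F (y - t *\<^sub>R w))) - ln (norm (y - t *\<^sub>R w)) - I (norm (y - t *\<^sub>R w))) =
       L (y - t *\<^sub>R w)"
    proof -
      have "((\<lambda>t. y - t *\<^sub>R w) \<longlongrightarrow> y - 0 *\<^sub>R w) (nhds (0::real))"
        by (intro tendsto_intros filterlim_ident)
      then have "\<forall>\<^sub>F t in nhds 0. y - t *\<^sub>R w \<in> ball 0 1 - {0}"
        using y1 y by (intro topological_tendstoD) (auto intro: open_delete)
      then show ?thesis
        by eventually_elim (auto simp: L_def Q_def ln_div nz)
    qed
    ultimately have "((\<lambda>t. L (y - t *\<^sub>R w)) has_real_derivative s * (A / q \<rho> - 1)) (at 0)"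
      by (rule DERIV_cong_ev[OF refl _ refl, THEN iffD1, rotated])
    moreover have "s * (A / q \<rho> - 1) \<le> 0"
    proof -
      have "s * A \<le> s * q \<rho>"
        using cmp \<rho>(1) by (simp add: wy mult_le_cancel_right flip: \<rho>_def mult.assoc)
      then show ?thesis
        using qp by (simp add: field_simps)
    qed
    ultimately show ?thesis
      using w by blast
  qed
  ultimately have "0 \<le> L z"
    by (intro nonneg_if_descent_directions) auto
  then show ?thesis
    using z by (simp add: L_def Q_def I_def)
qed


section \<open>Real parts of admissible functions\<close>

text \<open>A continuous injective real function on an interval is strictly monotone, and \<sigma>
  records the direction. Since \<sigma> does not depend on the radius, the maximum of g(y) and g(-y)
  becomes the single smooth function g(\<sigma>y) for all y in [0, 1).\<close>

lemma admissible_monotone_real_axis: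
  assumes "admissible g"
  obtains \<sigma> :: real where "\<sigma> = 1 \<or> \<sigma> = - 1"
    and "\<And>x y. - 1 < x \<Longrightarrow> x \<le> y \<Longrightarrow> y < 1 \<Longrightarrow>
      Re (g (of_real (\<sigma> * x))) \<le> Re (g (of_real (\<sigma> * y)))"
proof -
  define G where "G x = Re (g (of_real x))" for x :: real
  define S :: "real set" where "S = {- 1<..<1}"
  have hol: "g holomorphic_on ball 0 1" and inj: "inj_on g (ball 0 1)"
    and sym: "\<And>\<zeta>. \<zeta> \<in> ball 0 1 \<Longrightarrow> g (cnj \<zeta>) = cnj (g \<zeta>)"
    using assms by (auto simp: admissible_def)
  have "continuous_on S G"
    unfolding G_def S_def
    by (intro continuous_intros continuous_on_compose2[OF holomorphic_on_imp_continuous_on[OF hol]]) auto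
  moreover have "inj_on G S"
  proof (rule inj_onI)
    fix x y assume xy: "x \<in> S" "y \<in> S" "G x = G y"
    have real: "g (of_real x) \<in> \<real>" if "x \<in> S" for x
      using sym[of "of_real x"] that by (auto simp: S_def Reals_cnj_iff)
    \<comment> \<open>Both values are real by the symmetry of \<open>g\<close>, so equal real parts
      give equal values and the injectivity of \<open>g\<close> applies.\<close>
    have "g (of_real x) = g (of_real y)"
      using real[OF xy(1)] real[OF xy(2)] xy(3) by (simp add: G_def complex_eq_iff complex_is_Real_iff)
    then show "x = y"
      using inj xy(1,2) by (auto simp: S_def dest!: inj_onD)
  qed
  moreover have "is_interval S" by (simp add: S_def is_interval_oo)
  ultimately consider "strict_mono_on S G" | "strict_antimono_on S G"
    using injective_eq_monotone_map by blast
  then show thesis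
  proof cases
    case 1
    then have "G x \<le> G y" if "- 1 < x" "x \<le> y" "y < 1" for x y
      using that by (auto simp: S_def strict_mono_on_leD)
    then show thesis
      by (intro that[of 1]) (auto simp: G_def)
  next
    case 2
    have "G (- x) \<le> G (- y)" if "- 1 < x" "x \<le> y" "y < 1" for x y
      using 2 that monotone_onD[OF 2, of "- y" "- x"] by (cases "x = y") (auto simp: S_def)
    then show thesis
      by (intro that[of "- 1"]) (auto simp: G_def)
  qed
qed

text \<open>Admissibility bounds the real part on the circle through \<open>\<xi>\<close>;
  monotonicity on the real axis then widens these bounds from radius \<open>norm \<xi>\<close> to
  \<open>r\<close>.\<close>

lemma admissible_Re_bounds:
  assumes adm: "admissible g" and \<xi>: "norm \<xi> \<le> r" and r: "r < 1"
  shows "min (Re (g (of_real r))) (Re (g (- of_real r))) \<le> Re (g \<xi>)"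
    and "Re (g \<xi>) \<le> max (Re (g (of_real r))) (Re (g (- of_real r)))"
proof -
  obtain \<sigma> :: real where \<sigma>: "\<sigma> = 1 \<or> \<sigma> = - 1"
    and mono: "\<And>x y. - 1 < x \<Longrightarrow> x \<le> y \<Longrightarrow> y < 1 \<Longrightarrow>
      Re (g (of_real (\<sigma> * x))) \<le> Re (g (of_real (\<sigma> * y)))"
    using admissible_monotone_real_axis[OF adm] by blast
  define \<rho> where "\<rho> = norm \<xi>"
  have \<rho>: "0 \<le> \<rho>" "\<rho> \<le> r" using \<xi> by (auto simp: \<rho>_def)
  have "min (Re (g (of_real \<rho>))) (Re (g (- of_real \<rho>))) \<le> Re (g \<xi>) \<and>
      Re (g \<xi>) \<le> max (Re (g (of_real \<rho>))) (Re (g (- of_real \<rho>)))"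
  \<comment> \<open>Admissibility speaks of positive radii only; at radius 0 both bounds are the
    value at the origin.\<close>
  proof (cases "\<rho> = 0")
    case False
    then have \<rho>': "0 < \<rho>" "\<rho> < 1" using \<rho> r by auto
    have "continuous_on (sphere 0 \<rho>) (\<lambda>\<zeta>. Re (g \<zeta>))"
      using adm \<rho>' by (auto simp: admissible_def intro!: continuous_intros
          continuous_on_subset[OF holomorphic_on_imp_continuous_on])
    then have "compact ((\<lambda>\<zeta>. Re (g \<zeta>)) ` sphere 0 \<rho>)"
      by (intro compact_continuous_image) auto
    \<comment> \<open>Infimum and supremum bound the values on the circle only once the set of
      values is known to be bounded.\<close>
    then have bdd: "bdd_below ((\<lambda>\<zeta>. Re (g \<zeta>)) ` sphere 0 \<rho>)" "bdd_above ((\<lambda>\<zeta>. Re (g \<zeta>)) ` sphere 0 \<rho>)"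
      by (auto dest!: compact_imp_bounded simp: bounded_imp_bdd_below bounded_imp_bdd_above)
    have \<xi>S: "\<xi> \<in> sphere 0 \<rho>" by (simp add: \<rho>_def)
    show ?thesis
      using cINF_lower[OF bdd(1) \<xi>S] cSUP_upper[OF \<xi>S bdd(2)] adm \<rho>'
      by (simp add: admissible_def)
  qed (simp add: \<rho>_def)
  then show "min (Re (g (of_real r))) (Re (g (- of_real r))) \<le> Re (g \<xi>)"
    and "Re (g \<xi>) \<le> max (Re (g (of_real r))) (Re (g (- of_real r)))"
    using \<sigma> mono[of \<rho> r] mono[of "- r" "- \<rho>"] mono[of "- \<rho>" \<rho>] \<rho> r
    by (auto simp: min_def max_def split: if_splits)
qed

text \<open>Supplies what \<open>log_growth_comparison\<close> asks of \<open>q\<close>, for the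
  maximum and the minimum alike, according to the sign \<sigma>. The derivative at 0 comes from the
  complex derivative of \<open>g\<close>.\<close>

lemma admissible_extremal_function:
  fixes \<sigma> :: real
  assumes adm: "admissible g" and \<alpha>: "0 \<le> \<alpha>" "\<alpha> < 1" and \<sigma>: "\<sigma> = 1 \<or> \<sigma> = - 1"
  defines "q \<equiv> \<lambda>y. (1 - \<alpha>) * Re (g (of_real (\<sigma> * y))) + \<alpha>"
  shows "continuous_on {0..<1} q" and "\<And>y. y \<in> {0..<1} \<Longrightarrow> 0 < q y" and "q 0 = 1"
    and "\<exists>d. (q has_real_derivative d) (at 0 within {0..})"
proof -
  have hol: "g holomorphic_on ball 0 1" and pos: "\<And>\<zeta>. \<zeta> \<in> ball 0 1 \<Longrightarrow> 0 < Re (g \<zeta>)" and "g 0 = 1"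
    using adm by (auto simp: admissible_def)
  have "continuous_on {0..<1} (\<lambda>y. g (of_real (\<sigma> * y)))"
    using \<sigma> by (intro continuous_on_compose2[OF holomorphic_on_imp_continuous_on[OF hol]] continuous_intros) auto
  then show "continuous_on {0..<1} q"
    unfolding q_def by (intro continuous_intros)
  show "0 < q y" if "y \<in> {0..<1}" for y
    using pos[of "of_real (\<sigma> * y)"] \<alpha> \<sigma> that
    by (auto simp: q_def intro!: add_pos_nonneg)
  show "q 0 = 1" using \<open>g 0 = 1\<close> by (simp add: q_def)
  have "(g has_field_derivative deriv g 0) (at 0)"
    using hol by (simp add: holomorphic_derivI)
  then have "((\<lambda>y. g (of_real \<sigma> * y)) has_field_derivative deriv g 0 * of_real \<sigma>) (at (of_real 0))"
    by (intro DERIV_chain2) (auto intro!: derivative_eq_intros)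
  from has_vector_derivative_real_field[OF this, of UNIV]
  have "((\<lambda>y. Re (g (of_real \<sigma> * of_real y))) has_real_derivative Re (deriv g 0 * of_real \<sigma>)) (at 0)"
    by (rule has_field_derivative_Re)
  then have "(q has_real_derivative (1 - \<alpha>) * Re (deriv g 0 * of_real \<sigma>)) (at 0)"
    unfolding q_def using DERIV_add[OF DERIV_cmult DERIV_const, of _ _ 0 UNIV "1 - \<alpha>" \<alpha>] by simp
  then show "\<exists>d. (q has_real_derivative d) (at 0 within {0..})"
    using has_field_derivative_at_within by blast
qed

section \<open>The Hermitian product and complex lines\<close>

lemma bounded_linear_cinner_left: "bounded_linear (\<lambda>v. cinner v u)"
  by (rule linear_conv_bounded_linear[THEN iffD1], rule linearI)
    (simp_all add: cinner_def algebra_simps sum.distrib scaleR_sum_right)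

lemma cinner_smult_left: "cinner (c *s v) u = c * cinner v u"
  by (simp add: cinner_def sum_distrib_left mult.assoc)

lemma cinner_smult_right: "cinner v (c *s u) = cnj c * cinner v u"
  by (simp add: cinner_def sum_distrib_left mult_ac)

lemma scaleR_eq_smult: "r *\<^sub>R (v :: complex ^ 'n) = of_real r *s v"
  by (subst vec_eq_iff) (simp add: scaleR_conv_of_real[where 'a = complex])

lemma norm_smult: "norm (c *s (v :: complex ^ 'n)) = norm c * norm v"
  by (simp add: norm_vec_def norm_mult L2_set_right_distrib)

lemma inner_eq_Re_cinner: "v \<bullet> u = Re (cinner v u)"
  by (simp add: inner_vec_def cinner_def inner_complex_def)

text \<open>Complex linearity of the derivative makes the restriction to a complex line holomorphic
  in one variable, which gives access to Schwarz's lemma.\<close>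

lemma has_field_derivative_slice:
  fixes h :: "complex ^ 'n \<Rightarrow> complex ^ 'n"
  assumes "(h has_derivative (\<lambda>v. A *v v)) (at (\<zeta> *s u))"
  shows "((\<lambda>\<zeta>. cinner (h (\<zeta> *s u)) u) has_field_derivative cinner (A *v u) u) (at \<zeta>)"
proof -
  have lin: "bounded_linear (\<lambda>t :: complex. t *s u)"
    by (rule linear_conv_bounded_linear[THEN iffD1], rule linearI) (simp_all add: vec_eq_iff algebra_simps)
  have "((\<lambda>\<zeta>. h (\<zeta> *s u)) has_derivative (\<lambda>t. A *v (t *s u))) (at \<zeta>)"
    using diff_chain_at[OF bounded_linear_imp_has_derivative[OF lin] assms] by (simp add: o_def)
  then have "((\<lambda>\<zeta>. cinner (h (\<zeta> *s u)) u) has_derivative (\<lambda>t. cinner (A *v (t *s u)) u)) (at \<zeta>)"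
    by (rule bounded_linear.has_derivative[OF bounded_linear_cinner_left])
  moreover have "A *v (t *s u) = t *s (A *v u)" for t
    by (simp add: vector_scalar_commute)
  ultimately show ?thesis
    by (simp add: has_field_derivative_def cinner_smult_left mult_commute_abs)
qed

lemma holomorphic_map_on_has_derivative_jacobian:
  assumes "holomorphic_map_on f S" "x \<in> S"
  shows "(f has_derivative (\<lambda>v. jacobian f (at x) *v v)) (at x)"
proof -
  obtain A where "(f has_derivative (\<lambda>v. A *v v)) (at x)"
    using assms by (auto simp: holomorphic_map_on_def)
  then show ?thesis
    by (metis jacobian_holomorphic(1))
qed

section \<open>Subordination by Schwarz's lemma\<close>

text \<open>On the line through \<open>z\<close>, the function \<open>k\<close>, which is
  \<open>f \<zeta> / \<zeta>\<close> off 0, is holomorphic with \<open>k 0 = 1\<close>, and the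
  affine map \<open>P\<close> carries its values into the image of \<open>g\<close>. As
  \<open>P 1 = 1 = g 0\<close>, the composition of \<open>k\<close>, \<open>P\<close> and the
  inverse of \<open>g\<close> is a self-map of the disc fixing 0, and \<open>\<xi>\<close> is its
  value at \<open>norm z\<close>.\<close>

lemma M_class_subordination:
  fixes h :: "complex ^ 'n \<Rightarrow> complex ^ 'n"
  assumes adm: "admissible g" and \<alpha>: "\<alpha> < 1" and h: "h \<in> M_class g \<alpha> \<beta>"
    and z: "z \<in> ball 0 1" "z \<noteq> 0"
  obtains \<xi> where "norm \<xi> \<le> norm z"
    and "(1 - \<i> * of_real (tan \<beta>)) * cinner (h z) z =
      of_real ((norm z)\<^sup>2) * ((1 - of_real \<alpha>) * g \<xi> + of_real \<alpha> - \<i> * of_real (tan \<beta>))"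
proof -
  define c where "c = 1 - \<i> * of_real (tan \<beta>)"
  define a where "a = 1 - (of_real \<alpha> :: complex)"
  \<comment> \<open>The affine map in the definition of \<open>M_class\<close>: here
    \<open>a - c\<close> equals - \<alpha> + \<i> tan \<beta>.\<close>
  define P where "P w = (a - c) / a + c / a * w" for w
  define u where "u = (1 / norm z) *\<^sub>R z"
  define f where "f \<zeta> = cinner (h (\<zeta> *s u)) u" for \<zeta>
  define k where "k \<zeta> = (if \<zeta> = 0 then deriv f 0 else (f \<zeta> - f 0) / (\<zeta> - 0))" for \<zeta>
  have a0: "a \<noteq> 0" using \<alpha> by (simp add: a_def complex_eq_iff)
  have nu: "norm u = 1" using z by (simp add: u_def)
  have hol: "g holomorphic_on ball 0 1" and inj: "inj_on g (ball 0 1)" and g0: "g 0 = 1"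
    using adm by (auto simp: admissible_def)
  have hm: "holomorphic_map_on h (ball 0 1)" and h0: "h 0 = 0" and J: "jacobian h (at 0) = mat 1"
    using h by (auto simp: M_class_def)
  have dh: "(h has_derivative (\<lambda>v. jacobian h (at x) *v v)) (at x)" if "x \<in> ball 0 1" for x
    by (rule holomorphic_map_on_has_derivative_jacobian[OF hm that])
  have su: "\<zeta> *s u \<in> ball 0 1" if "\<zeta> \<in> ball 0 1" for \<zeta>
    using that nu by (simp add: norm_smult)
  have df: "(f has_field_derivative cinner (jacobian h (at (\<zeta> *s u)) *v u) u) (at \<zeta>)"
    if "\<zeta> \<in> ball 0 1" for \<zeta>
    unfolding f_def using su[OF that] dh by (intro has_field_derivative_slice) auto
  have "f holomorphic_on ball 0 1"
    using df by (force simp: holomorphic_on_open)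
  then have holk: "k holomorphic_on ball 0 1"
    unfolding k_def by (rule pole_lemma_open) auto
  have f0: "f 0 = 0" by (simp add: f_def h0 cinner_def)
  have "cinner u u = 1" using nu norm_eq_sqrt_cinner(1)[of u] by simp
  then have k0: "k 0 = 1"
    using DERIV_imp_deriv[OF df[of 0]] J by (simp add: k_def)
  have kx: "P (k \<zeta>) \<in> g ` ball 0 1" if \<zeta>: "\<zeta> \<in> ball 0 1" for \<zeta>
  proof (cases "\<zeta> = 0")
    case True
    have "P 1 = 1" using a0 by (simp add: P_def field_simps)
    then show ?thesis using True k0 g0 by (metis centre_in_ball image_eqI zero_less_one)
  next
    case False
    have "\<zeta> *s u \<noteq> 0" using False nu by auto
    then have "(- of_real \<alpha> + \<i> * of_real (tan \<beta>)) / (1 - of_real \<alpha>)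
          + (1 - \<i> * of_real (tan \<beta>)) / (1 - of_real \<alpha>)
            * cinner (h (\<zeta> *s u)) ((1 / (norm (\<zeta> *s u))\<^sup>2) *\<^sub>R (\<zeta> *s u)) \<in> g ` ball 0 1"
      using h su[OF \<zeta>] by (auto simp: M_class_def)
    \<comment> \<open>As \<open>u\<close> is a unit vector, the normalization contributes the
      conjugate of \<zeta> over its squared modulus, that is 1/\<zeta>.\<close>
    moreover have "cinner (h (\<zeta> *s u)) ((1 / (norm (\<zeta> *s u))\<^sup>2) *\<^sub>R (\<zeta> *s u)) = k \<zeta>"
    proof -
      have "cinner (h (\<zeta> *s u)) ((1 / (norm (\<zeta> *s u))\<^sup>2) *\<^sub>R (\<zeta> *s u)) =
          of_real (1 / (norm \<zeta>)\<^sup>2) * (cnj \<zeta> * f \<zeta>)"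
        by (simp add: scaleR_eq_smult norm_smult nu cinner_smult_right f_def)
      also have "\<dots> = f \<zeta> / \<zeta>"
        using False by (simp add: complex_norm_square field_simps del: of_real_power)
      finally show ?thesis using False f0 by (simp add: k_def)
    qed
    moreover have "P w = (- of_real \<alpha> + \<i> * of_real (tan \<beta>)) / (1 - of_real \<alpha>)
          + (1 - \<i> * of_real (tan \<beta>)) / (1 - of_real \<alpha>) * w" for w
      unfolding P_def c_def a_def by (simp add: algebra_simps)
    ultimately show ?thesis by simp
  qed
  obtain gi where holgi: "gi holomorphic_on (g ` ball 0 1)" and gi: "\<And>\<zeta>. \<zeta> \<in> ball 0 1 \<Longrightarrow> gi (g \<zeta>) = \<zeta>"
    using holomorphic_has_inverse[OF hol open_ball inj] by metis
  define \<omega> where "\<omega> \<zeta> = gi (P (k \<zeta>))" for \<zeta>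
  have gw: "\<omega> \<zeta> \<in> ball 0 1" "g (\<omega> \<zeta>) = P (k \<zeta>)" if "\<zeta> \<in> ball 0 1" for \<zeta>
    using kx[OF that] gi by (auto simp: \<omega>_def)
  have "(gi \<circ> (\<lambda>\<zeta>. P (k \<zeta>))) holomorphic_on ball 0 1"
    using kx a0 by (intro holomorphic_on_compose_gen[OF _ holgi])
      (auto simp: P_def intro!: holomorphic_intros holk)
  then have "\<omega> holomorphic_on ball 0 1" by (simp add: \<omega>_def[abs_def] o_def)
  moreover have "\<omega> 0 = 0"
  proof -
    have "P 1 = 1" using a0 by (simp add: P_def field_simps)
    then show ?thesis using gi[of 0] k0 g0 by (simp add: \<omega>_def)
  qed
  ultimately have "norm (\<omega> (norm z)) \<le> norm (of_real (norm z) :: complex)"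
    using gw z by (intro Schwarz_Lemma(1)) auto
  \<comment> \<open>The relation \<open>g (\<omega> \<zeta>) = P (k \<zeta>)\<close> is solved for
    \<open>c * k \<zeta>\<close> at \<zeta> = \<open>norm z\<close>, the parameter at which the line
    meets \<open>z\<close>.\<close>
  moreover have "c * cinner (h z) z = of_real ((norm z)\<^sup>2) * (a * g (\<omega> (norm z)) - (a - c))"
  proof -
    have zu: "of_real (norm z) *s u = z"
      using z by (simp add: u_def flip: scaleR_eq_smult)
    have "cinner (h z) z = of_real (norm z) * f (norm z)"
      using cinner_smult_right[of "h z" "of_real (norm z)" u] by (simp add: f_def zu)
    moreover have "f (norm z) = of_real (norm z) * k (norm z)"
      using z f0 by (simp add: k_def)
    ultimately have "cinner (h z) z = of_real ((norm z)\<^sup>2) * k (norm z)"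
      by (simp add: power2_eq_square)
    moreover have "a * g (\<omega> (norm z)) - (a - c) = c * k (norm z)"
      using gw(2)[of "of_real (norm z)"] z a0 by (simp add: P_def distrib_left)
    ultimately show ?thesis by simp
  qed
  ultimately show thesis
    using that[of "\<omega> (norm z)"] by (simp add: a_def c_def algebra_simps)
qed


lemma matrix_vector_mult_matrix_inv:
  fixes A :: "complex ^ 'n ^ 'n"
  assumes "invertible A"
  shows "A *v (matrix_inv A *v x) = x"
proof -
  have "A ** matrix_inv A = mat 1"
    using assms someI_ex[of "\<lambda>B. A ** B = mat 1 \<and> B ** A = mat 1"]
    by (simp add: invertible_def matrix_inv_def)
  then show ?thesis
    by (simp add: matrix_vector_mul_assoc)
qed

section \<open>Growth of the mappings in the class\<close>

text \<open>One statement covers both estimates: \<open>s = 1\<close> goes with the sign that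
  maximizes the real part of \<open>g\<close>, and \<open>s = - 1\<close> with the one that
  minimizes it. The nonvanishing of \<open>F z\<close> makes the logarithm meaningful.\<close>

lemma S_class_log_growth:
  fixes F :: "complex ^ 'n \<Rightarrow> complex ^ 'n"
  assumes adm: "admissible g" and \<alpha>: "0 \<le> \<alpha>" "\<alpha> < 1" and F: "F \<in> S_class g \<alpha> \<beta>"
    and \<sigma>: "\<sigma> = 1 \<or> \<sigma> = - 1"
    and bound: "\<And>\<xi> r. norm \<xi> \<le> r \<Longrightarrow> r < 1 \<Longrightarrow> s * Re (g \<xi>) \<le> s * Re (g (of_real (\<sigma> * r)))"
    and z: "z \<in> ball 0 1" "z \<noteq> 0"
  shows "F z \<noteq> 0"
    and "0 \<le> s * (ln (norm (F z) / norm z) -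
      integral {0..norm z} (log_kernel (\<lambda>y. (1 - \<alpha>) * Re (g (of_real (\<sigma> * y))) + \<alpha>)))"
proof -
  define q where "q = (\<lambda>y. (1 - \<alpha>) * Re (g (of_real (\<sigma> * y))) + \<alpha>)"
  define c where "c = 1 - \<i> * of_real (tan \<beta>)"
  define J where "J x = jacobian F (at x)" for x
  define h where "h x = matrix_inv (J x) *v F x" for x
  have F0: "F 0 = 0" and J0: "J 0 = mat 1" and inv: "\<And>x. x \<in> ball 0 1 \<Longrightarrow> invertible (J x)"
    and h: "h \<in> M_class g \<alpha> \<beta>"
    using F by (auto simp: S_class_def J_def h_def[abs_def])
  have dF: "(F has_derivative (\<lambda>v. J x *v v)) (at x)" if "x \<in> ball 0 1" for x
    using F that holomorphic_map_on_has_derivative_jacobian[of F "ball 0 1" x]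
    by (simp add: S_class_def J_def)
  have contF: "continuous_on (ball 0 1) F"
    using dF[THEN has_derivative_continuous] by (simp add: continuous_on_eq_continuous_at)
  have flow: "0 < (c *s h x) \<bullet> x \<and> s * ((c *s h x) \<bullet> x) \<le> s * (q (norm x) * (norm x)\<^sup>2)"
    if x: "x \<in> ball 0 1" "x \<noteq> 0" for x
  proof -
    obtain \<xi> where \<xi>: "norm \<xi> \<le> norm x" and eq: "c * cinner (h x) x =
        of_real ((norm x)\<^sup>2) * ((1 - of_real \<alpha>) * g \<xi> + of_real \<alpha> - \<i> * of_real (tan \<beta>))"
      using M_class_subordination[OF adm \<alpha>(2) h x] unfolding c_def by blast
    \<comment> \<open>The real inner product is the real part of the Hermitian one, and taking real
      parts removes the term with tan \<beta>.\<close>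
    have Re: "(c *s h x) \<bullet> x = (norm x)\<^sup>2 * ((1 - \<alpha>) * Re (g \<xi>) + \<alpha>)"
      by (simp add: inner_eq_Re_cinner cinner_smult_left eq del: of_real_power)
    have "0 < Re (g \<xi>)"
      using adm \<xi> x by (auto simp: admissible_def)
    then have "0 < (1 - \<alpha>) * Re (g \<xi>) + \<alpha>"
      using \<alpha> by (auto intro: add_pos_nonneg)
    moreover have "s * ((1 - \<alpha>) * Re (g \<xi>) + \<alpha>) \<le> s * q (norm x)"
      using mult_left_mono[OF bound[OF \<xi>], of "1 - \<alpha>"] x \<alpha> by (simp add: q_def algebra_simps)
    then have "(norm x)\<^sup>2 * (s * ((1 - \<alpha>) * Re (g \<xi>) + \<alpha>)) \<le> (norm x)\<^sup>2 * (s * q (norm x))"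
      by (rule mult_left_mono) simp
    ultimately show ?thesis
      using x unfolding Re by (simp add: mult_ac)
  qed
  \<comment> \<open>A zero of \<open>F\<close> at \<open>x\<close> would be a zero of
    \<open>h\<close>, against the strict positivity in \<open>flow\<close>.\<close>
  have nz: "F x \<noteq> 0" if "x \<in> ball 0 1" "x \<noteq> 0" for x
  proof
    assume "F x = 0"
    then have "c *s h x = 0" by (simp add: h_def)
    then have "(c *s h x) \<bullet> x = 0" by (simp only: inner_zero_left)
    then show False using flow[OF that] by linarith
  qed
  show "F z \<noteq> 0" using nz z by blast
  have dir: "\<exists>w F'. (F has_derivative F') (at x) \<and> F' w \<bullet> F x = F x \<bullet> F x \<and> 0 < w \<bullet> x \<and>
      s * (w \<bullet> x) \<le> s * (q (norm x) * (norm x)\<^sup>2)" if x: "x \<in> ball 0 1" "x \<noteq> 0" for x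
  proof (intro exI[of _ "c *s h x"] exI[of _ "\<lambda>v. J x *v v"] conjI)
    \<comment> \<open>The Jacobian cancels against its inverse in \<open>h\<close>, so the direction
      is mapped to \<open>c *s F x\<close>; \<open>Re c = 1\<close> then makes the inner product
      with \<open>F x\<close> the squared norm.\<close>
    have "J x *v (c *s h x) = c *s F x"
      using inv[OF x(1)] by (simp add: vector_scalar_commute h_def matrix_vector_mult_matrix_inv)
    moreover have "cinner (F x) (F x) = of_real ((norm (F x))\<^sup>2)"
      using norm_eq_sqrt_cinner(1)[of "F x"] by simp
    moreover have "Re c = 1"
      by (simp add: c_def)
    ultimately show "(J x *v (c *s h x)) \<bullet> F x = F x \<bullet> F x"
      by (simp add: inner_eq_Re_cinner cinner_smult_left del: of_real_power)
  qed (use dF flow x in auto)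
  have "(F has_derivative (\<lambda>v. v)) (at 0)"
    using dF[of 0] J0 by simp
  moreover obtain d where "(q has_real_derivative d) (at 0 within {0..})"
    using admissible_extremal_function(4)[OF adm \<alpha> \<sigma>] unfolding q_def by blast
  moreover have "continuous_on {0..<1} q" "\<And>y. y \<in> {0..<1} \<Longrightarrow> 0 < q y" "q 0 = 1"
    unfolding q_def using admissible_extremal_function(1-3)[OF adm \<alpha> \<sigma>] by blast+
  ultimately have "0 \<le> s * (ln (norm (F z) / norm z) - integral {0..norm z} (log_kernel q))"
    using z by (intro log_growth_comparison[OF contF F0 _ nz dir])
  then show "0 \<le> s * (ln (norm (F z) / norm z) -
      integral {0..norm z} (log_kernel (\<lambda>y. (1 - \<alpha>) * Re (g (of_real (\<sigma> * y))) + \<alpha>)))"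
    by (simp add: q_def)
qed

theorem theorem2p4:
  fixes g :: "complex \<Rightarrow> complex" and \<alpha> \<beta> :: real
    and F :: "complex ^ 'n \<Rightarrow> complex ^ 'n" and z :: "complex ^ 'n"
  assumes "admissible g"
    and "0 \<le> \<alpha>" and "\<alpha> < 1"
    and "- (pi / 2) < \<beta>" and "\<beta> < pi / 2"
    and "F \<in> S_class g \<alpha> \<beta>"
    and "z \<in> ball 0 1"
  shows "norm z * exp (integral {0..norm z} (\<lambda>y.
             (1 / ((1 - \<alpha>) * (max (Re (g (of_real y))) (Re (g (- of_real y))) + \<alpha> / (1 - \<alpha>))) - 1)
               * (1 / y))) \<le> norm (F z) \<and>
         norm (F z) \<le> norm z * exp (integral {0..norm z} (\<lambda>y.
             (1 / ((1 - \<alpha>) * (min (Re (g (of_real y))) (Re (g (- of_real y))) + \<alpha> / (1 - \<alpha>))) - 1)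
               * (1 / y)))"
proof (cases "z = 0")
  case True
  then show ?thesis
    using assms(6) by (simp add: S_class_def)
next
  case False
  obtain \<sigma> :: real where \<sigma>: "\<sigma> = 1 \<or> \<sigma> = - 1"
    and mono: "\<And>x y. - 1 < x \<Longrightarrow> x \<le> y \<Longrightarrow> y < 1 \<Longrightarrow>
      Re (g (of_real (\<sigma> * x))) \<le> Re (g (of_real (\<sigma> * y)))"
    using admissible_monotone_real_axis[OF assms(1)] by blast
  then have \<sigma>': "- \<sigma> = 1 \<or> - \<sigma> = - 1" by auto
  \<comment> \<open>For nonnegative \<open>y\<close>, monotonicity between \<open>- y\<close> and
    \<open>y\<close> decides which of the two values is larger.\<close>
  have ext: "max (Re (g (of_real y))) (Re (g (- of_real y))) = Re (g (of_real (\<sigma> * y)))"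
    "min (Re (g (of_real y))) (Re (g (- of_real y))) = Re (g (of_real (- \<sigma> * y)))"
    if "0 \<le> y" "y < 1" for y
    using \<sigma> mono[of "- y" y] that by auto
  have nneg: "0 \<le> r" if "norm \<xi> \<le> r" for \<xi> :: complex and r
    using that norm_ge_zero order_trans by blast
  have bounds: "1 * Re (g \<xi>) \<le> 1 * Re (g (of_real (\<sigma> * r)))"
    "- 1 * Re (g \<xi>) \<le> - 1 * Re (g (of_real (- \<sigma> * r)))" if "norm \<xi> \<le> r" "r < 1" for \<xi> r
    using admissible_Re_bounds[OF assms(1) that] ext[OF nneg[OF that(1)] that(2)] by auto
  have cancel: "(1 - \<alpha>) * (t + \<alpha> / (1 - \<alpha>)) = (1 - \<alpha>) * t + \<alpha>" for t
    using assms(3) by (simp add: distrib_left)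
  define I1 where "I1 = integral {0..norm z} (log_kernel (\<lambda>y. (1 - \<alpha>) * Re (g (of_real (\<sigma> * y))) + \<alpha>))"
  define I2 where "I2 = integral {0..norm z} (log_kernel (\<lambda>y. (1 - \<alpha>) * Re (g (of_real (- \<sigma> * y))) + \<alpha>))"
  have I1: "integral {0..norm z} (\<lambda>y.
             (1 / ((1 - \<alpha>) * (max (Re (g (of_real y))) (Re (g (- of_real y))) + \<alpha> / (1 - \<alpha>))) - 1)
               * (1 / y)) = I1"
    unfolding I1_def log_kernel_def cancel using assms(7) ext(1) by (intro integral_cong) simp
  have I2: "integral {0..norm z} (\<lambda>y.
             (1 / ((1 - \<alpha>) * (min (Re (g (of_real y))) (Re (g (- of_real y))) + \<alpha> / (1 - \<alpha>))) - 1)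
               * (1 / y)) = I2"
    unfolding I2_def log_kernel_def cancel using assms(7) ext(2) by (intro integral_cong) simp
  note growth = S_class_log_growth[OF assms(1-3,6) _ _ assms(7) False]
  have "F z \<noteq> 0" using growth(1)[OF \<sigma> bounds(1)] by blast
  then have pos: "0 < norm (F z) / norm z" "0 < norm z" using False by auto
  \<comment> \<open>The sign \<sigma> with \<open>s = 1\<close> yields the lower bound, and -
    \<sigma> with \<open>s = - 1\<close> the upper one.\<close>
  have "I1 \<le> ln (norm (F z) / norm z)" "ln (norm (F z) / norm z) \<le> I2"
    using growth(2)[OF \<sigma> bounds(1)] growth(2)[OF \<sigma>' bounds(2)] by (auto simp: I1_def I2_def)
  then have "exp I1 \<le> norm (F z) / norm z" "norm (F z) / norm z \<le> exp I2"
    using pos by (simp_all add: ln_ge_iff flip: exp_le_cancel_iff[of "ln _"])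
  then show ?thesis
    unfolding I1 I2 using pos(2) by (simp add: field_simps)
qed

end
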